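(* Let $\Theta,\Theta_*\subset\mathbb{R}^p$, let $\phi:\Theta\to\Theta_*$ be a one-to-one differentiable transformation of $\Theta$ onto $\Theta_*$ with differentiable inverse $\phi^{-1}:\Theta_*\to\Theta$, and let $K(\theta_* )=\partial\phi^{-1}(\theta_* )/\partial\theta_*^\top$ be its $p\times p$ Jacobian matrix, assumed to be of full rank for every $\theta_*\in\Theta_*$. Let $g:\Theta\to\mathbb{R}^q$ be continuously differentiable with $q\times p$ Jacobian $G(\theta)=\partial g(\theta)/\partial\theta^\top$ of full row rank. Let $g_*:\Theta_*\to\mathbb{R}^q$ be continuously differentiable with Jacobian $G_*(\theta_* )=\partial g_*(\theta_* )/\partial\theta_*^\top$, and such that, for $\theta\in\Theta$, $g_*(\phi(\theta))=0$ if and only if $g(\theta)=0$. Let $Q_n$ and $Q_n^*$ be the objective functions in the original and in the new parametrization, let $A,B$ and $A_*(\theta_* ),B_*(\theta_* )$ be the associated matrices, let $\widehat\theta_n,\widetilde\theta_n$ be the unrestricted and constrained extremum estimators in the original parametrization and $\widehat\theta_*=\phi(\widehat\theta_n)$, $\widetilde\theta_*=\phi(\widetilde\theta_n)$ those in the new parametrization, and let $BF_n(g)$ and $BF_n(g_* )$ be the bilinear form statistics, all as defined in the context. Suppose that for all $\theta\in\Theta$, with $\theta_*=\phi(\theta)$: B1. $G_*(\theta_* )=G(\theta)\,K(\phi(\theta))$; B2. $[G(\theta)K(\phi(\theta))]^+=K^+(\phi(\theta))\,G^+(\theta)$, where $^+$ denotes the Moore-Penrose inverse; B3. $\dfrac{\partial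 Q_n^*(\theta_* )}{\partial\theta_*}=K^\top(\phi(\theta))\,\dfrac{\partial Q_n(\theta)}{\partial\theta}$; B4. $A_*(\theta_* )=K^\top(\phi(\theta))\,A\,K(\phi(\theta))$; B5. $B_*(\theta_* )=K^\top(\phi(\theta))\,B\,K(\phi(\theta))$; B6. $g_*(\theta_* )=g(\phi^{-1}(\theta_* ))$. Then the bilinear form test statistic is invariant, i.e. $BF_n(g_* )=BF_n(g)$.
   Context: Extremum estimation: $Q_n(\theta)$ is a (twice differentiable) real objective function of a parameter $\theta\in\Theta\subset\mathbb{R}^p$, depending on observed data $z_1,\dots,z_n$. The unrestricted extremum estimator $\widehat\theta_n$ maximizes $Q_n$ over $\Theta$; the constrained estimator $\widetilde\theta_n$ solves $\max_{\theta\in\Theta}Q_n(\theta)$ subject to $g(\theta)=0$. Gradients $\partial Q_n/\partial\theta$ are column vectors. Standing regularity conditions: with $A_n(\theta)=\partial^2Q_n(\theta)/\partial\theta\,\partial\theta^\top$, (A1) $A_n(\theta)\to A$ almost surely, uniformly in $\theta$, with $A$ a nonsingular $p\times p$ matrix; (A2) $\sqrt n\,\partial Q_n(\theta)/\partial\theta$ converges in distribution to $\mathsf N_p(0,B)$. Bilinear form (BF) statistic for testing $H_0:g(\theta)=0$ in the original parametrization: $$BF_n(g)=n\Big\{\frac{\partial Q_n(\widetilde\theta_n)}{\partial\theta}\Big\}^\top G^+\,S\,\Omega^{-1}\,g(\widehat\theta_n),$$ with $S=G(-A)^{-1}G^\top$, $\Omega=GA^{-1}BA^{-1}G^\top$ (assumed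 nonsingular), and $G^+=G^\top(GG^\top)^{-1}$ the Moore-Penrose inverse of $G$, where $G=G(\widetilde\theta_n)$. In the new parametrization $\theta_*=\phi(\theta)\in\Theta_*$, $Q_n^*:\Theta_*\to\mathbb{R}$ denotes the objective function expressed in terms of $\theta_*$, and $A_*(\theta_* ),B_*(\theta_* )$ denote the $p\times p$ matrices that play the roles of $A,B$ for the reparametrized problem (what is assumed about them is stated in B4 and B5). The BF statistic for testing $H_0^*:g_*(\theta_* )=0$ is $$BF_n(g_* )=n\Big\{\frac{\partial Q_n^*(\widetilde\theta_* )}{\partial\theta_*}\Big\}^\top G_*^+\,S_*\,\Omega_*^{-1}\,g_*(\widehat\theta_* ),$$ with $S_*=G_*(-A_* )^{-1}G_*^\top$, $\Omega_*=G_*A_*^{-1}B_*A_*^{-1}G_*^\top$, where $G_*,A_*,B_*$ are evaluated at $\widetilde\theta_*$ and $G_*^+$ is the Moore-Penrose inverse of $G_*$. *)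

theory Defs
  imports "HOL-Probability.Probability"
begin

text \<open>An element of \<open>real^'p^'q\<close> is a matrix with \<open>CARD('q)\<close> rows and \<open>CARD('p)\<close> columns.
  Jacobians and gradients are carried as explicit functions. Parameter sets are arbitrary subsets
  of Euclidean space, so derivatives are taken within the set; on an open set this is the usual
  derivative.\<close>

definition has_jacobian_on ::
  "(real^'p \<Rightarrow> real^'q) \<Rightarrow> (real^'p \<Rightarrow> real^'p^'q) \<Rightarrow> (real^'p) set \<Rightarrow> bool" where
  "has_jacobian_on f J S \<longleftrightarrow> (\<forall>x\<in>S. (f has_derivative (\<lambda>h. J x *v h)) (at x within S))"

definition has_gradient_on ::
  "(real^'p \<Rightarrow> real) \<Rightarrow> (real^'p \<Rightarrow> real^'p) \<Rightarrow> (real^'p) set \<Rightarrow> bool" where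
  "has_gradient_on f D S \<longleftrightarrow> (\<forall>x\<in>S. (f has_derivative (\<lambda>h. h \<bullet> D x)) (at x within S))"


text \<open>The Moore-Penrose inverse, by the four Penrose conditions.\<close>

definition is_mp_inverse :: "real^'n^'m \<Rightarrow> real^'m^'n \<Rightarrow> bool" where
  "is_mp_inverse M X \<longleftrightarrow>
     M ** X ** M = M \<and> X ** M ** X = X \<and>
     transpose (M ** X) = M ** X \<and> transpose (X ** M) = X ** M"

definition mp_inverse :: "real^'n^'m \<Rightarrow> real^'m^'n" where
  "mp_inverse M = (THE X. is_mp_inverse M X)"

lemma is_mp_inverse_unique:
  fixes M :: "real^'n^'m"
  assumes X: "is_mp_inverse M X" and Y: "is_mp_inverse M Y"
  shows "X = Y"
proof -
  have a: "M ** X = M ** Y"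
  proof -
    have "M ** X = (M ** Y) ** (M ** X)"
      using Y by (simp add: is_mp_inverse_def matrix_mul_assoc)
    also have "\<dots> = transpose (M ** Y) ** transpose (M ** X)"
      using X Y by (simp add: is_mp_inverse_def)
    also have "\<dots> = transpose ((M ** X) ** (M ** Y))"
      by (simp add: matrix_transpose_mul)
    also have "(M ** X) ** (M ** Y) = M ** Y"
      using X by (simp add: is_mp_inverse_def matrix_mul_assoc)
    also have "transpose (M ** Y) = M ** Y"
      using Y by (simp add: is_mp_inverse_def)
    finally show ?thesis .
  qed
  have b: "X ** M = Y ** M"
  proof -
    have "X ** M = (X ** M) ** (Y ** M)"
      using Y by (metis is_mp_inverse_def matrix_mul_assoc)
    also have "\<dots> = transpose (X ** M) ** transpose (Y ** M)"
      using X Y by (simp add: is_mp_inverse_def)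
    also have "\<dots> = transpose ((Y ** M) ** (X ** M))"
      by (simp add: matrix_transpose_mul)
    also have "(Y ** M) ** (X ** M) = Y ** M"
      using X by (metis is_mp_inverse_def matrix_mul_assoc)
    also have "transpose (Y ** M) = Y ** M"
      using Y by (simp add: is_mp_inverse_def)
    finally show ?thesis .
  qed
  have "X = X ** (M ** X)" using X by (simp add: is_mp_inverse_def matrix_mul_assoc)
  also have "\<dots> = Y ** M ** Y" using a b by (simp add: matrix_mul_assoc)
  also have "\<dots> = Y" using Y by (simp add: is_mp_inverse_def)
  finally show ?thesis .
qed

lemma mp_inverse_eqI: "is_mp_inverse M X \<Longrightarrow> mp_inverse M = X"
  unfolding mp_inverse_def by (blast intro: the_equality is_mp_inverse_unique)

lemma invertible_matrix_inv:
  fixes M :: "real^'n^'n"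
  assumes "invertible M"
  shows "M ** matrix_inv M = mat 1" "matrix_inv M ** M = mat 1"
  using someI_ex[of "\<lambda>X. M ** X = mat 1 \<and> X ** M = mat 1"] assms
  unfolding invertible_def matrix_inv_def by auto

lemma invertible_gram:
  fixes M :: "real^'n^'m"
  assumes "rank M = CARD('m)"
  shows "invertible (M ** transpose M)"
proof -
  have inj: "inj ((*v) (transpose M))"
    using assms by (simp add: full_rank_injective[symmetric] rank_transpose)
  have "x = 0" if x: "(M ** transpose M) *v x = 0" for x
  proof -
    have "(transpose M *v x) \<bullet> (transpose M *v x) = x \<bullet> ((M ** transpose M) *v x)"
      by (simp add: dot_lmul_matrix[symmetric] matrix_vector_mul_assoc[symmetric])
    then have "transpose M *v x = transpose M *v 0" using x by simp
    then show "x = 0" using inj by (blast dest: injD)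
  qed
  then show ?thesis
    by (auto simp: invertible_left_inverse matrix_left_invertible_ker)
qed

lemma mp_inverse_full_row_rank:
  fixes M :: "real^'n^'m"
  assumes "rank M = CARD('m)"
  shows "mp_inverse M = transpose M ** matrix_inv (M ** transpose M)"
proof (rule mp_inverse_eqI)
  let ?S = "M ** transpose M" and ?I = "matrix_inv (M ** transpose M)"
  note inv = invertible_matrix_inv[OF invertible_gram[OF assms]]
  have sym: "transpose ?I = ?I"
  proof -
    have 1: "transpose ?I ** ?S = mat 1"
      using arg_cong[OF inv(1), of transpose]
      by (simp add: matrix_transpose_mul transpose_mat)
    have "transpose ?I = transpose ?I ** (?S ** ?I)" using inv by simp
    also have "\<dots> = (transpose ?I ** ?S) ** ?I" by (simp only: matrix_mul_assoc)
    also have "\<dots> = ?I" using 1 by simp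
    finally show ?thesis .
  qed
  have MX: "M ** (transpose M ** ?I) = mat 1" using inv by (simp only: matrix_mul_assoc)
  show "is_mp_inverse M (transpose M ** ?I)"
    unfolding is_mp_inverse_def
  proof (intro conjI)
    show "(transpose M ** ?I) ** M ** (transpose M ** ?I) = transpose M ** ?I"
      by (metis MX matrix_mul_assoc matrix_mul_rid)
    show "transpose (transpose M ** ?I ** M) = transpose M ** ?I ** M"
      by (simp add: matrix_transpose_mul sym matrix_mul_assoc)
  qed (simp_all add: MX transpose_mat)
qed


text \<open>The law \<open>N(0, V)\<close>, characterized as usual by its one-dimensional projections; \<open>V\<close> may be
  singular, in which case some projections are point masses at 0.\<close>

definition is_centered_normal :: "(real^'p) measure \<Rightarrow> real^'p^'p \<Rightarrow> bool" where
  "is_centered_normal \<mu> V \<longleftrightarrow>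
     prob_space \<mu> \<and> sets \<mu> = sets borel \<and>
     transpose V = V \<and> (\<forall>t. 0 \<le> t \<bullet> (V *v t)) \<and>
     (\<forall>t. distr \<mu> borel (\<lambda>x. t \<bullet> x) =
        (if t \<bullet> (V *v t) = 0 then return borel 0
         else density lborel (\<lambda>x. ennreal (normal_density 0 (sqrt (t \<bullet> (V *v t))) x))))"

definition converges_in_distribution ::
  "'w measure \<Rightarrow> (nat \<Rightarrow> 'w \<Rightarrow> 'a::topological_space) \<Rightarrow> 'a measure \<Rightarrow> bool" where
  "converges_in_distribution P X \<mu> \<longleftrightarrow>
     (\<forall>n. X n \<in> borel_measurable P) \<and>
     (\<forall>f::'a \<Rightarrow> real. continuous_on UNIV f \<and> bounded (range f) \<longrightarrow>
        (\<lambda>n. integral\<^sup>L P (\<lambda>w. f (X n w))) \<longlonglongrightarrow> integral\<^sup>L \<mu> f)"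


definition sample :: "(nat \<Rightarrow> 'w \<Rightarrow> 'z) \<Rightarrow> nat \<Rightarrow> 'w \<Rightarrow> 'z list" where
  "sample z n w = map (\<lambda>i. z i w) [1..<Suc n]"

definition unrestricted_estimate :: "(real^'p \<Rightarrow> real) \<Rightarrow> (real^'p) set \<Rightarrow> real^'p \<Rightarrow> bool" where
  "unrestricted_estimate Q \<Theta> \<theta> \<longleftrightarrow> is_arg_max Q (\<lambda>t. t \<in> \<Theta>) \<theta>"

definition constrained_estimate ::
  "(real^'p \<Rightarrow> real) \<Rightarrow> (real^'p) set \<Rightarrow> (real^'p \<Rightarrow> real^'q) \<Rightarrow> real^'p \<Rightarrow> bool" where
  "constrained_estimate Q \<Theta> g \<theta> \<longleftrightarrow> is_arg_max Q (\<lambda>t. t \<in> \<Theta> \<and> g t = 0) \<theta>"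


definition S_matrix :: "real^'p^'q \<Rightarrow> real^'p^'p \<Rightarrow> real^'q^'q" where
  "S_matrix G A = G ** matrix_inv (- A) ** transpose G"

definition Omega_matrix :: "real^'p^'q \<Rightarrow> real^'p^'p \<Rightarrow> real^'p^'p \<Rightarrow> real^'q^'q" where
  "Omega_matrix G A B = G ** matrix_inv A ** B ** matrix_inv A ** transpose G"

text \<open>\<open>dQ\<close> is the gradient of the objective function, \<open>th\<close> the unrestricted and \<open>tc\<close> the constrained
  estimate. \<open>A\<close> and \<open>B\<close> are functions of the parameter, as needed after reparametrization; in the
  original parametrization they are constant.\<close>

definition BF_stat ::
  "nat \<Rightarrow> (real^'p \<Rightarrow> real^'p) \<Rightarrow> (real^'p \<Rightarrow> real^'p^'p) \<Rightarrow> (real^'p \<Rightarrow> real^'p^'p) \<Rightarrow>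
   (real^'p \<Rightarrow> real^'q) \<Rightarrow> (real^'p \<Rightarrow> real^'p^'q) \<Rightarrow> real^'p \<Rightarrow> real^'p \<Rightarrow> real" where
  "BF_stat n dQ A B g G th tc =
     real n * (dQ tc \<bullet>
       ((mp_inverse (G tc) ** S_matrix (G tc) (A tc)
          ** matrix_inv (Omega_matrix (G tc) (A tc) (B tc))) *v g th))"

end

theory Submission
  imports Defs
begin

text \<open>Since \<open>K (K\<^sup>T A K)\<^sup>-\<^sup>1 K\<^sup>T = A\<^sup>-\<^sup>1\<close>, the matrices \<open>S\<close> and \<open>\<Omega>\<close> do not change when \<open>G, A, B\<close> are
  replaced by \<open>G K, K\<^sup>T A K, K\<^sup>T B K\<close>. In the bilinear form, the factor \<open>K\<^sup>T\<close> of the new gradient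
  cancels against the factor \<open>K\<^sup>+ = K\<^sup>-\<^sup>1\<close> of \<open>(G K)\<^sup>+\<close>.\<close>

text \<open>A right inverse of a square matrix is automatically two-sided, so a single product is
  enough to identify \<open>matrix_inv\<close>.\<close>

lemma matrix_inv_eqI:
  fixes M X :: "real^'n^'n"
  assumes "M ** X = mat 1"
  shows "matrix_inv M = X"
proof -
  have "invertible M"
    using assms by (auto simp: invertible_right_inverse)
  then have "matrix_inv M = matrix_inv M ** (M ** X)"
    using assms by simp
  also have "\<dots> = X"
    using \<open>invertible M\<close> by (simp add: matrix_mul_assoc invertible_matrix_inv)
  finally show ?thesis .
qed

text \<open>Both products with the ordinary inverse are \<open>mat 1\<close>, which makes the four
  Penrose conditions immediate. This turns the factor \<open>K^+\<close> in \<open>B2\<close> into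
  an honest inverse.\<close>

lemma mp_inverse_invertible:
  fixes M :: "real^'n^'n"
  assumes "invertible M"
  shows "mp_inverse M = matrix_inv M"
  using assms
  by (intro mp_inverse_eqI) (simp add: is_mp_inverse_def invertible_matrix_inv transpose_mat)

text \<open>The inverse of \<open>K^T A K\<close> is \<open>K^-1 A^-1 K^-T\<close>, and the outer
  factors remove \<open>K^-1\<close> and \<open>K^-T\<close>. The left side is the block that arises
  when \<open>G\<close> becomes \<open>G K\<close> on the left and \<open>K^T G^T\<close> on the
  right.\<close>

lemma mult_matrix_inv_congruence:
  fixes A K :: "real^'n^'n"
  assumes "invertible A" "invertible K"
  shows "K ** matrix_inv (transpose K ** A ** K) ** transpose K = matrix_inv A"
proof -
  have cancel: "matrix_inv K ** K = mat 1" "K ** matrix_inv K = mat 1"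
    using assms by (simp_all add: invertible_matrix_inv)
  have cancelT: "transpose K ** transpose (matrix_inv K) = mat 1"
      "transpose (matrix_inv K) ** transpose K = mat 1"
    \<comment> \<open>Reading \<open>matrix_transpose_mul\<close> backwards merges each product into
      the transpose of a product that \<open>cancel\<close> evaluates.\<close>
    by (simp_all add: cancel transpose_mat flip: matrix_transpose_mul)
  have "(transpose K ** A ** K) ** (matrix_inv K ** matrix_inv A ** transpose (matrix_inv K)) =
      transpose K ** (A ** ((K ** matrix_inv K) ** matrix_inv A)) ** transpose (matrix_inv K)"
    by (simp only: matrix_mul_assoc)
  also have "\<dots> = mat 1"
    using assms by (simp add: cancel cancelT invertible_matrix_inv)
  finally have "matrix_inv (transpose K ** A ** K) =
      matrix_inv K ** matrix_inv A ** transpose (matrix_inv K)"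
    by (rule matrix_inv_eqI)
  then have "K ** matrix_inv (transpose K ** A ** K) ** transpose K =
      (K ** matrix_inv K) ** matrix_inv A ** (transpose (matrix_inv K) ** transpose K)"
    by (simp only: matrix_mul_assoc)
  then show ?thesis
    by (simp add: cancel cancelT)
qed

lemma matrix_mult_minus:
  fixes M :: "real^'n^'m" and N :: "real^'k^'n"
  shows "(- M) ** N = - (M ** N)" "M ** (- N) = - (M ** N)"
  by (simp_all add: matrix_matrix_mult_def vec_eq_iff sum_negf)

text \<open>The inverse inside \<open>S_matrix\<close> is that of \<open>- A\<close>, so the
  cancellation is applied to \<open>- A\<close>, using
  \<open>K^T (- A) K = - (K^T A K)\<close>.\<close>

lemma S_matrix_congruence:
  fixes A K :: "real^'p^'p" and G :: "real^'p^'q"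
  assumes "invertible A" "invertible K"
  shows "S_matrix (G ** K) (transpose K ** A ** K) = S_matrix G A"
proof -
  have "(- A) ** (- matrix_inv A) = mat 1"
    using assms by (simp add: matrix_mult_minus invertible_matrix_inv)
  then have "invertible (- A)"
    by (auto simp: invertible_right_inverse)
  have "S_matrix (G ** K) (transpose K ** A ** K) =
      G ** (K ** matrix_inv (transpose K ** (- A) ** K) ** transpose K) ** transpose G"
    by (simp add: S_matrix_def matrix_transpose_mul matrix_mul_assoc matrix_mult_minus)
  then show ?thesis
    using mult_matrix_inv_congruence[OF \<open>invertible (- A)\<close> assms(2)] by (simp add: S_matrix_def)
qed

text \<open>The middle factor \<open>K^T B K\<close> lends its \<open>K^T\<close> to the inverse on
  its left and its \<open>K\<close> to the inverse on its right; with the \<open>K\<close> and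
  \<open>K^T\<close> coming from \<open>G K\<close>, the cancelling block \<open>?C\<close> appears
  twice.\<close>

lemma Omega_matrix_congruence:
  fixes A B K :: "real^'p^'p" and G :: "real^'p^'q"
  assumes "invertible A" "invertible K"
  shows "Omega_matrix (G ** K) (transpose K ** A ** K) (transpose K ** B ** K) = Omega_matrix G A B"
proof -
  let ?C = "K ** matrix_inv (transpose K ** A ** K) ** transpose K"
  have "Omega_matrix (G ** K) (transpose K ** A ** K) (transpose K ** B ** K) =
      G ** ?C ** B ** ?C ** transpose G"
    by (simp add: Omega_matrix_def matrix_transpose_mul matrix_mul_assoc)
  then show ?thesis
    unfolding mult_matrix_inv_congruence[OF assms] by (simp add: Omega_matrix_def)
qed

theorem theorem3p1:
  fixes \<Theta> \<Theta>s :: "(real^'p) set"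
    and \<phi> :: "real^'p \<Rightarrow> real^'p"
    and K :: "real^'p \<Rightarrow> real^'p^'p"
    and g gs :: "real^'p \<Rightarrow> real^'q"
    and G Gs :: "real^'p \<Rightarrow> real^'p^'q"
    and P :: "'w measure" and N :: "'z measure" and z :: "nat \<Rightarrow> 'w \<Rightarrow> 'z"
    and Q Qs :: "nat \<Rightarrow> 'z list \<Rightarrow> real^'p \<Rightarrow> real"
    and dQ dQs :: "nat \<Rightarrow> 'z list \<Rightarrow> real^'p \<Rightarrow> real^'p"
    and H :: "nat \<Rightarrow> 'z list \<Rightarrow> real^'p \<Rightarrow> real^'p^'p"
    and A B :: "real^'p^'p" and As Bs :: "real^'p \<Rightarrow> real^'p^'p"
    and \<theta>0 :: "real^'p" and \<mu> :: "(real^'p) measure"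
    and n :: nat and w :: 'w and \<theta>hat \<theta>til :: "real^'p"
  assumes phi_bij: "bij_betw \<phi> \<Theta> \<Theta>s"
    and phi_diff: "\<phi> differentiable_on \<Theta>"
    and K_jac: "has_jacobian_on (inv_into \<Theta> \<phi>) K \<Theta>s"
    and K_rank: "\<And>t. t \<in> \<Theta>s \<Longrightarrow> rank (K t) = CARD('p)"
    and G_jac: "has_jacobian_on g G \<Theta>" and G_cont: "continuous_on \<Theta> G"
    and G_rank: "\<And>\<theta>. \<theta> \<in> \<Theta> \<Longrightarrow> rank (G \<theta>) = CARD('q)"
    and Gs_jac: "has_jacobian_on gs Gs \<Theta>s" and Gs_cont: "continuous_on \<Theta>s Gs"
    and null_iff: "\<And>\<theta>. \<theta> \<in> \<Theta> \<Longrightarrow> gs (\<phi> \<theta>) = 0 \<longleftrightarrow> g \<theta> = 0"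
    and prob: "prob_space P"
    and data: "\<And>i. i \<ge> 1 \<Longrightarrow> z i \<in> measurable P N"
    and Q_grad: "\<And>k v. k \<ge> 1 \<Longrightarrow> v \<in> space P \<Longrightarrow>
       has_gradient_on (Q k (sample z k v)) (dQ k (sample z k v)) \<Theta>"
    and Q_hess: "\<And>k v. k \<ge> 1 \<Longrightarrow> v \<in> space P \<Longrightarrow>
       has_jacobian_on (dQ k (sample z k v)) (H k (sample z k v)) \<Theta>"
    and A1: "AE v in P. uniform_limit \<Theta> (\<lambda>k. H k (sample z k v)) (\<lambda>_. A) sequentially"
    and A_nonsing: "invertible A"
    and true_par: "\<theta>0 \<in> \<Theta>"
    and B_normal: "is_centered_normal \<mu> B"
    and A2: "converges_in_distribution P
       (\<lambda>k v. sqrt (real k) *\<^sub>R dQ k (sample z k v) \<theta>0) \<mu>"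
    and Qs_eq: "\<And>k v t. k \<ge> 1 \<Longrightarrow> v \<in> space P \<Longrightarrow> t \<in> \<Theta>s \<Longrightarrow>
       Qs k (sample z k v) t = Q k (sample z k v) ((inv_into \<Theta> \<phi>) t)"
    and Qs_grad: "\<And>k v. k \<ge> 1 \<Longrightarrow> v \<in> space P \<Longrightarrow>
       has_gradient_on (Qs k (sample z k v)) (dQs k (sample z k v)) \<Theta>s"
    and B1: "\<And>\<theta>. \<theta> \<in> \<Theta> \<Longrightarrow> Gs (\<phi> \<theta>) = G \<theta> ** K (\<phi> \<theta>)"
    and B2: "\<And>\<theta>. \<theta> \<in> \<Theta> \<Longrightarrow>
       mp_inverse (G \<theta> ** K (\<phi> \<theta>)) = mp_inverse (K (\<phi> \<theta>)) ** mp_inverse (G \<theta>)"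
    and B3: "\<And>k v \<theta>. k \<ge> 1 \<Longrightarrow> v \<in> space P \<Longrightarrow> \<theta> \<in> \<Theta> \<Longrightarrow>
       dQs k (sample z k v) (\<phi> \<theta>) = transpose (K (\<phi> \<theta>)) *v dQ k (sample z k v) \<theta>"
    and B4: "\<And>\<theta>. \<theta> \<in> \<Theta> \<Longrightarrow> As (\<phi> \<theta>) = transpose (K (\<phi> \<theta>)) ** A ** K (\<phi> \<theta>)"
    and B5: "\<And>\<theta>. \<theta> \<in> \<Theta> \<Longrightarrow> Bs (\<phi> \<theta>) = transpose (K (\<phi> \<theta>)) ** B ** K (\<phi> \<theta>)"
    and B6: "\<And>\<theta>. \<theta> \<in> \<Theta> \<Longrightarrow> gs (\<phi> \<theta>) = g ((inv_into \<Theta> \<phi>) (\<phi> \<theta>))"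
    and n: "n \<ge> 1" and w: "w \<in> space P"
    and hat: "unrestricted_estimate (Q n (sample z n w)) \<Theta> \<theta>hat"
    and til: "constrained_estimate (Q n (sample z n w)) \<Theta> g \<theta>til"
    and Omega_nonsing: "invertible (Omega_matrix (G \<theta>til) A B)"
  shows "BF_stat n (dQs n (sample z n w)) As Bs gs Gs (\<phi> \<theta>hat) (\<phi> \<theta>til) =
         BF_stat n (dQ n (sample z n w)) (\<lambda>_. A) (\<lambda>_. B) g G \<theta>hat \<theta>til"
proof -
  \<comment> \<open>Both estimates are maximizers over subsets of \<open>\<Theta>\<close>, so
    \<open>B1\<close> to \<open>B6\<close> may be instantiated at them.\<close>
  have mem: "\<theta>hat \<in> \<Theta>" "\<theta>til \<in> \<Theta>"
    using hat til
    by (simp_all add: unrestricted_estimate_def constrained_estimate_def is_arg_max_def)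
  \<comment> \<open>The gradient and all matrices of the statistic are taken at the constrained
    estimate, so this is the only value of \<open>K\<close> that enters; the unrestricted estimate
    occurs only as argument of the constraint function.\<close>
  define L where "L = K (\<phi> \<theta>til)"
  have "\<phi> \<theta>til \<in> \<Theta>s"
    using phi_bij mem by (auto simp: bij_betw_def)
  then have "inj ((*v) L)"
    using K_rank full_rank_injective unfolding L_def by blast
  then have L: "invertible L"
    by (simp add: invertible_left_inverse matrix_left_invertible_injective)
  have g_eq: "gs (\<phi> \<theta>hat) = g \<theta>hat"
    using B6[OF mem(1)] phi_bij mem(1) by (simp add: bij_betw_def inv_into_f_f)
  have dQ_eq: "dQs n (sample z n w) (\<phi> \<theta>til) = transpose L *v dQ n (sample z n w) \<theta>til"
    using B3[OF n w mem(2)] by (simp add: L_def)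
  have mp: "mp_inverse (G \<theta>til ** L) = matrix_inv L ** mp_inverse (G \<theta>til)"
    using B2[OF mem(2)] mp_inverse_invertible[OF L] by (simp add: L_def)
  \<comment> \<open>\<open>R\<close> collects the factors that are the same in both
    parametrizations.\<close>
  define R where "R = S_matrix (G \<theta>til) A ** matrix_inv (Omega_matrix (G \<theta>til) A B)"
  have "BF_stat n (dQs n (sample z n w)) As Bs gs Gs (\<phi> \<theta>hat) (\<phi> \<theta>til) =
      real n * ((transpose L *v dQ n (sample z n w) \<theta>til) \<bullet>
        ((matrix_inv L ** mp_inverse (G \<theta>til) ** R) *v g \<theta>hat))"
    by (simp add: BF_stat_def B1 B4 B5 mem dQ_eq g_eq mp R_def
        S_matrix_congruence[OF A_nonsing L] Omega_matrix_congruence[OF A_nonsing L]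
        matrix_mul_assoc flip: L_def)
  \<comment> \<open>By adjointness \<open>transpose L\<close> moves across the inner product and
    becomes \<open>L\<close>, landing directly in front of \<open>matrix_inv L\<close>.\<close>
  also have "\<dots> = real n * (dQ n (sample z n w) \<theta>til \<bullet>
      (((L ** matrix_inv L) ** mp_inverse (G \<theta>til) ** R) *v g \<theta>hat))"
    by (simp add: dot_lmul_matrix matrix_vector_mul_assoc matrix_mul_assoc)
  also have "\<dots> = BF_stat n (dQ n (sample z n w)) (\<lambda>_. A) (\<lambda>_. B) g G \<theta>hat \<theta>til"
    by (simp add: BF_stat_def R_def invertible_matrix_inv[OF L] matrix_mul_assoc)
  finally show ?thesis .
qed

end
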